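(* Let $G$ be a regular graph on $n\ge 2$ vertices. Then $$b(G)\ge \frac{\mathrm{iso}(G)}{2}.$$
   Context: Graphs are finite, simple, undirected and unweighted. A graph is regular if all its vertices have the same degree. For a graph $G$ with vertex set $V(G)$, $|V(G)|=n\ge 2$, and edge set $E(G)$, the $\ell_1$-Fiedler value is $$b(G)=\min\Big\{\sum_{uv\in E(G)}|x_u-x_v| : x\in\mathbb{R}^{V(G)},\ \sum_{v\in V(G)}x_v=0,\ \sum_{v\in V(G)}|x_v|=1\Big\}.$$ For nonempty $S\subsetneq V(G)$, $S^c=V(G)\setminus S$, let $\partial S=\{uv\in E(G):u\in S,\ v\in S^c\}$. The isoperimetric number is $\mathrm{iso}(G)=\min\{|\partial S|/|S| : S\subseteq V(G),\ 0<|S|\le \lfloor n/2\rfloor\}$. *)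

theory Defs
  imports "HOL-Analysis.Analysis"
begin

locale finite_simple_graph =
  fixes V :: "'a set" and E :: "'a set set"
  assumes finite_vertices: "finite V"
    and edges: "e \<in> E \<Longrightarrow> e \<subseteq> V \<and> card e = 2"

definition degree :: "'a set set \<Rightarrow> 'a \<Rightarrow> nat" where
  "degree E v = card {e \<in> E. v \<in> e}"

definition regular_graph :: "'a set \<Rightarrow> 'a set set \<Rightarrow> bool" where
  "regular_graph V E \<longleftrightarrow> (\<exists>d. \<forall>v\<in>V. degree E v = d)"

text \<open>The value \<open>\<bar>x\<^sub>u - x\<^sub>v\<bar>\<close> depends only on the unordered pair \<open>{u, v}\<close>,
  so every edge is counted once in the sums below.\<close>

definition edge_diff :: "('a \<Rightarrow> real) \<Rightarrow> 'a set \<Rightarrow> real" where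
  "edge_diff x e = (THE d. \<exists>u v. e = {u, v} \<and> d = \<bar>x u - x v\<bar>)"

lemma edge_diff_doubleton [simp]: "edge_diff x {u, v} = \<bar>x u - x v\<bar>"
  unfolding edge_diff_def
  by (rule the_equality) (auto simp: doubleton_eq_iff abs_minus_commute)

text \<open>A vector in \<open>\<real>\<^sup>V\<close> is represented by a function on the whole vertex type, of which only
  the values on \<open>V\<close> are used.\<close>

definition l1_fiedler_values :: "'a set \<Rightarrow> 'a set set \<Rightarrow> real set" where
  "l1_fiedler_values V E =
     {(\<Sum>e\<in>E. edge_diff x e) | x. (\<Sum>v\<in>V. x v) = 0 \<and> (\<Sum>v\<in>V. \<bar>x v\<bar>) = 1}"

text \<open>\<open>Min\<close> is meant for finite sets only, so the minimum of this infinite set is taken by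
  \<open>LEAST\<close>; \<open>l1_fiedler_minimum\<close> below shows that it exists.\<close>

definition l1_fiedler :: "'a set \<Rightarrow> 'a set set \<Rightarrow> real" where
  "l1_fiedler V E = (LEAST r. r \<in> l1_fiedler_values V E)"

definition edge_boundary :: "'a set \<Rightarrow> 'a set set \<Rightarrow> 'a set \<Rightarrow> 'a set set" where
  "edge_boundary V E S = {e \<in> E. \<exists>u\<in>S. \<exists>v\<in>V - S. e = {u, v}}"

definition iso_number :: "'a set \<Rightarrow> 'a set set \<Rightarrow> real" where
  "iso_number V E =
     Min {real (card (edge_boundary V E S)) / real (card S) | S.
            S \<subseteq> V \<and> 0 < card S \<and> card S \<le> card V div 2}"

lemma l1_fiedler_values_attain_min:
  assumes G: "finite_simple_graph V E" and n: "card V \<ge> 2"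
  shows "\<exists>m\<in>l1_fiedler_values V E. \<forall>r\<in>l1_fiedler_values V E. m \<le> r"
proof -
  interpret finite_simple_graph V E by (fact G)
  define B :: "('a \<Rightarrow> real) set" where "B = (\<Pi>\<^sub>E v\<in>UNIV. if v \<in> V then {-1..1} else {0})"
  define K where "K = B \<inter> ({x. (\<Sum>v\<in>V. x v) = 0} \<inter> {x. (\<Sum>v\<in>V. \<bar>x v\<bar>) = 1})"
  have coord: "continuous_on S (\<lambda>x::'a \<Rightarrow> real. x v)" for v S
    by (rule continuous_on_subset[OF continuous_on_product_coordinates subset_UNIV])
  have "compactin (product_topology (\<lambda>v::'a. euclidean :: real topology) UNIV) B"
    unfolding B_def compactin_PiE by (auto simp: compactin_euclidean_iff)
  then have "compact B"
    by (simp add: euclidean_product_topology)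
  moreover have "closed {x::'a \<Rightarrow> real. (\<Sum>v\<in>V. x v) = 0}"
      "closed {x::'a \<Rightarrow> real. (\<Sum>v\<in>V. \<bar>x v\<bar>) = 1}"
    by (rule closed_Collect_eq; intro continuous_on_sum continuous_on_rabs continuous_on_const coord)+
  ultimately have cpt: "compact K"
    unfolding K_def by (intro compact_Int_closed closed_Int)
  obtain a b where ab: "a \<in> V" "b \<in> V" "a \<noteq> b"
    using n finite_vertices by (metis card_le_Suc0_iff_eq not_less_eq_eq numeral_2_eq_2)
  define y where "y v = (if v = a then 1/2 else if v = b then -1/2 else 0 :: real)" for v
  have y: "y = (\<lambda>v. (if v = a then 1/2 else 0) - (if v = b then 1/2 else 0))"
      "(\<lambda>v. \<bar>y v\<bar>) = (\<lambda>v. (if v = a then 1/2 else 0) + (if v = b then 1/2 else 0))"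
    using ab by (auto simp: y_def)
  have "(\<Sum>v\<in>V. y v) = 0"
    unfolding y(1) sum_subtractf using ab finite_vertices by simp
  moreover have "(\<Sum>v\<in>V. \<bar>y v\<bar>) = 1"
    unfolding y(2) sum.distrib using ab finite_vertices by simp
  moreover have "y \<in> B"
    using ab by (auto simp: B_def PiE_iff y_def)
  ultimately have ne: "K \<noteq> {}"
    by (auto simp: K_def)
  have "continuous_on K (\<lambda>x. \<Sum>e\<in>E. edge_diff x e)"
  proof (intro continuous_on_sum)
    fix e assume "e \<in> E"
    then obtain u v where "e = {u, v}"
      using edges by (metis card_2_iff)
    then show "continuous_on K (\<lambda>x. edge_diff x e)"
      by (auto intro!: continuous_intros coord)
  qed
  from continuous_attains_inf[OF cpt ne this] obtain x0 where
    x0: "x0 \<in> K" "\<And>x. x \<in> K \<Longrightarrow> (\<Sum>e\<in>E. edge_diff x0 e) \<le> (\<Sum>e\<in>E. edge_diff x e)"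
    by blast
  show ?thesis
  proof (intro bexI ballI)
    show "(\<Sum>e\<in>E. edge_diff x0 e) \<in> l1_fiedler_values V E"
      using x0(1) by (auto simp: l1_fiedler_values_def K_def)
  next
    fix r assume "r \<in> l1_fiedler_values V E"
    then obtain x where r: "r = (\<Sum>e\<in>E. edge_diff x e)"
      and x: "(\<Sum>v\<in>V. x v) = 0" "(\<Sum>v\<in>V. \<bar>x v\<bar>) = 1"
      by (auto simp: l1_fiedler_values_def)
    define z where "z v = (if v \<in> V then x v else 0)" for v
    have "\<bar>x v\<bar> \<le> 1" if "v \<in> V" for v
      using member_le_sum[of v V "\<lambda>v. \<bar>x v\<bar>"] that finite_vertices x(2) by simp
    then have "z \<in> B"
      by (force simp: B_def PiE_iff z_def abs_le_iff)
    moreover have "(\<Sum>v\<in>V. z v) = (\<Sum>v\<in>V. x v)" "(\<Sum>v\<in>V. \<bar>z v\<bar>) = (\<Sum>v\<in>V. \<bar>x v\<bar>)"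
      by (auto simp: z_def intro: sum.cong)
    ultimately have "z \<in> K"
      using x by (simp add: K_def)
    moreover have "edge_diff z e = edge_diff x e" if e: "e \<in> E" for e
    proof -
      obtain u v where "e = {u, v}"
        using edges[OF e] by (metis card_2_iff)
      then show ?thesis
        using edges[OF e] by (auto simp: z_def)
    qed
    ultimately show "(\<Sum>e\<in>E. edge_diff x0 e) \<le> r"
      using x0(2)[of z] r by simp
  qed
qed

lemma l1_fiedler_minimum:
  assumes "finite_simple_graph V E" and "card V \<ge> 2"
  shows "l1_fiedler V E \<in> l1_fiedler_values V E"
    and "r \<in> l1_fiedler_values V E \<Longrightarrow> l1_fiedler V E \<le> r"
proof -
  obtain m where m: "m \<in> l1_fiedler_values V E" "\<forall>r\<in>l1_fiedler_values V E. m \<le> r"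
    using l1_fiedler_values_attain_min[OF assms] by blast
  then have "l1_fiedler V E = m"
    unfolding l1_fiedler_def by (intro Least_equality) auto
  with m show "l1_fiedler V E \<in> l1_fiedler_values V E"
    and "r \<in> l1_fiedler_values V E \<Longrightarrow> l1_fiedler V E \<le> r" by auto
qed

end

(* A vector x with sum 0 and l1-norm 1 has positive and negative parts of mass 1/2 each, and one of
   the two is supported on at most half of the vertices. Passing to that part f does not increase
   the edge sum. Peeling f off in level sets S (the coarea argument), each layer contributes
   |\<partial>S| \<ge> iso(G) |S| per unit of height, so the edge sum of f is at least iso(G) times
   its mass. *)
theory Submission
  imports Defs
begin

lemma (in finite_simple_graph) finite_edges: "finite E"
  using finite_vertices edges by (intro finite_subset[of E "Pow V"]) auto

lemma (in finite_simple_graph) edge_doubletonE: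
  assumes "e \<in> E"
  obtains u v where "e = {u, v}" "u \<in> V" "v \<in> V"
  using edges[OF assms] by (auto simp: card_2_iff)

text \<open>Clearing the denominator admits the empty set, where the left side is 0, so level sets
  need no separate nonemptiness check.\<close>

lemma iso_number_le:
  assumes "finite V" "S \<subseteq> V" "card S \<le> card V div 2"
  shows "iso_number V E * card S \<le> card (edge_boundary V E S)"
proof (cases "card S = 0")
  case False
  have "{real (card (edge_boundary V E S)) / real (card S) | S.
            S \<subseteq> V \<and> 0 < card S \<and> card S \<le> card V div 2}
        \<subseteq> (\<lambda>S. real (card (edge_boundary V E S)) / real (card S)) ` Pow V"
    by auto
  then have "finite {real (card (edge_boundary V E S)) / real (card S) | S.
            S \<subseteq> V \<and> 0 < card S \<and> card S \<le> card V div 2}"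
    by (rule finite_subset) (simp add: assms(1))
  then have "iso_number V E \<le> real (card (edge_boundary V E S)) / real (card S)"
    unfolding iso_number_def using assms False by (intro Min_le) auto
  with False show ?thesis
    by (simp add: field_simps)
qed simp

text \<open>Induction on the size of the support replaces integration over thresholds. Each peeled
  layer has a smaller support, so the size bound \<open>k\<close> persists and \<open>bdry\<close>
  applies to every level set.\<close>

lemma (in finite_simple_graph) coarea_inequality:
  fixes f :: "'a \<Rightarrow> real" and c :: real
  assumes bdry: "\<And>S. S \<subseteq> V \<Longrightarrow> card S \<le> k \<Longrightarrow> c * card S \<le> card (edge_boundary V E S)"
    and "\<And>v. 0 \<le> f v" "card {v\<in>V. 0 < f v} \<le> k"
  shows "c * (\<Sum>v\<in>V. f v) \<le> (\<Sum>e\<in>E. edge_diff f e)"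
  using assms(2,3)
proof (induction "card {v\<in>V. 0 < f v}" arbitrary: f rule: less_induct)
  case less
  define S where "S = {v\<in>V. 0 < f v}"
  have S: "finite S" "S \<subseteq> V" "card S \<le> k"
    using less.prems finite_vertices by (auto simp: S_def)
  have nonneg: "0 \<le> edge_diff f e" if "e \<in> E" for e
    using that by (auto elim: edge_doubletonE)
  show ?case
  proof (cases "S = {}")
    case True
    have "f v = 0" if "v \<in> V" for v
      using True that less.prems(1)[of v] unfolding S_def by force
    then show ?thesis
      by (simp add: sum_nonneg nonneg)
  next
    case False
    \<comment> \<open>The least positive value: at every threshold in [0, \<open>m\<close>) the
      strict superlevel set of \<open>f\<close> in \<open>V\<close> is \<open>S\<close> itself, so
      the slab of height \<open>m\<close> is one layer.\<close>
    define m where "m = Min (f ` S)"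
    have "m \<in> f ` S"
      unfolding m_def using S False by (intro Min_in) auto
    then obtain w where w: "w \<in> S" "f w = m" by auto
    have m_pos: "0 < m" using w by (auto simp: S_def)
    have m_le: "m \<le> f v" if "v \<in> S" for v
      unfolding m_def using S that by auto
    have f0: "f v = 0" if "v \<in> V" "v \<notin> S" for v
      using that less.prems(1)[of v] unfolding S_def by force
    \<comment> \<open>Truncation keeps \<open>g\<close> nonnegative everywhere, including outside
      \<open>V\<close>, as the induction hypothesis requires.\<close>
    define g where "g v = max 0 (f v - m)" for v
    have g_in: "g v = f v - m" if "v \<in> S" for v
      using m_le[OF that] by (simp add: g_def)
    have g_out: "g v = 0" if "v \<in> V" "v \<notin> S" for v
      using f0[OF that] m_pos by (simp add: g_def)
    have "{v\<in>V. 0 < g v} \<subseteq> S - {w}"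
      using g_out g_in[OF w(1)] w(2) by force
    then have "{v\<in>V. 0 < g v} \<subset> S"
      using w(1) by blast
    then have "card {v\<in>V. 0 < g v} < card S"
      by (rule psubset_card_mono[OF S(1)])
    then have IH: "c * (\<Sum>v\<in>V. g v) \<le> (\<Sum>e\<in>E. edge_diff g e)"
      using S(3) by (intro less.hyps) (auto simp: S_def g_def)
    have "(\<Sum>v\<in>V. f v) = (\<Sum>v\<in>V. g v + (if v \<in> S then m else 0))"
      using g_in g_out f0 by (intro sum.cong) auto
    also have "\<dots> = (\<Sum>v\<in>V. g v) + m * card S"
      using finite_vertices S(2)
      by (simp add: sum.distrib sum.If_cases Int_absorb1)
    finally have mass: "(\<Sum>v\<in>V. f v) = (\<Sum>v\<in>V. g v) + m * card S" .
    \<comment> \<open>On a boundary edge the outer end stays at 0 while the inner end drops by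
      \<open>m\<close>; on any other edge both ends drop by the same amount.\<close>
    have "edge_diff f e = edge_diff g e + (if e \<in> edge_boundary V E S then m else 0)"
      if e: "e \<in> E" for e
    proof -
      obtain u v where uv: "e = {u, v}" "u \<in> V" "v \<in> V"
        using edge_doubletonE[OF e] .
      have "e \<in> edge_boundary V E S \<longleftrightarrow> (u \<in> S) \<noteq> (v \<in> S)"
        using e uv by (auto simp: edge_boundary_def doubleton_eq_iff)
      then show ?thesis
        using uv m_pos m_le[of u] m_le[of v] g_in[of u] g_in[of v] g_out[of u] g_out[of v]
          f0[of u] f0[of v]
        by (cases "u \<in> S"; cases "v \<in> S") auto
    qed
    then have "(\<Sum>e\<in>E. edge_diff f e)
        = (\<Sum>e\<in>E. edge_diff g e + (if e \<in> edge_boundary V E S then m else 0))"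
      by (rule sum.cong[OF refl])
    also have "\<dots> = (\<Sum>e\<in>E. edge_diff g e) + m * card (edge_boundary V E S)"
    proof -
      have "edge_boundary V E S \<subseteq> E"
        by (auto simp: edge_boundary_def)
      then show ?thesis
        using finite_edges by (simp add: sum.distrib sum.If_cases Int_absorb1)
    qed
    finally have energy: "(\<Sum>e\<in>E. edge_diff f e)
        = (\<Sum>e\<in>E. edge_diff g e) + m * card (edge_boundary V E S)" .
    have "m * (c * card S) \<le> m * card (edge_boundary V E S)"
      using bdry[OF S(2,3)] m_pos by (intro mult_left_mono) auto
    with IH show ?thesis
      by (simp add: mass energy algebra_simps)
  qed
qed

lemma (in finite_simple_graph) half_iso_number_le_of_small_positive_support:
  fixes x :: "'a \<Rightarrow> real"
  assumes "(\<Sum>v\<in>V. x v) = 0" "(\<Sum>v\<in>V. \<bar>x v\<bar>) = 1"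
    and "card {v\<in>V. 0 < x v} \<le> card V div 2"
  shows "iso_number V E / 2 \<le> (\<Sum>e\<in>E. edge_diff x e)"
proof -
  define f where "f v = max 0 (x v)" for v
  \<comment> \<open>This mass is the source of the factor 1/2 in the bound.\<close>
  have "(\<Sum>v\<in>V. f v) = (\<Sum>v\<in>V. (x v + \<bar>x v\<bar>) / 2)"
    by (intro sum.cong) (auto simp: f_def)
  also have "\<dots> = 1 / 2"
    using assms(1,2) by (simp add: sum.distrib flip: sum_divide_distrib)
  finally have mass: "(\<Sum>v\<in>V. f v) = 1 / 2" .
  have "iso_number V E * (\<Sum>v\<in>V. f v) \<le> (\<Sum>e\<in>E. edge_diff f e)"
    by (rule coarea_inequality[OF iso_number_le[OF finite_vertices]])
      (use assms(3) in \<open>auto simp: f_def less_max_iff_disj\<close>)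
  \<comment> \<open>The map \<open>max 0\<close> is 1-Lipschitz, so no edge difference
    grows.\<close>
  also have "\<dots> \<le> (\<Sum>e\<in>E. edge_diff x e)"
    by (rule sum_mono) (auto simp: f_def elim!: edge_doubletonE)
  finally show ?thesis
    unfolding mass by simp
qed

theorem theorem6p9:
  fixes V :: "'a set" and E :: "'a set set"
  assumes "finite_simple_graph V E"
    and "card V \<ge> 2"
    and "regular_graph V E"
  shows "l1_fiedler V E \<ge> iso_number V E / 2"
proof -
  interpret finite_simple_graph V E by (fact assms(1))
  obtain x where x: "l1_fiedler V E = (\<Sum>e\<in>E. edge_diff x e)"
      "(\<Sum>v\<in>V. x v) = 0" "(\<Sum>v\<in>V. \<bar>x v\<bar>) = 1"
    using l1_fiedler_minimum(1)[OF assms(1,2)] by (auto simp: l1_fiedler_values_def)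
  \<comment> \<open>Two disjoint supports cannot both exceed \<open>card V div 2\<close>, even with
    the rounding.\<close>
  have "card {v\<in>V. 0 < x v} + card {v\<in>V. 0 < - x v} = card ({v\<in>V. 0 < x v} \<union> {v\<in>V. 0 < - x v})"
    using finite_vertices by (intro card_Un_disjoint[symmetric]) auto
  also have "\<dots> \<le> card V"
    using finite_vertices by (intro card_mono) auto
  finally consider "card {v\<in>V. 0 < x v} \<le> card V div 2" | "card {v\<in>V. 0 < - x v} \<le> card V div 2"
    by linarith
  then show ?thesis
  proof cases
    case 1
    then show ?thesis
      using half_iso_number_le_of_small_positive_support x by simp
  next
    case 2
    \<comment> \<open>Negation swaps the two supports and preserves both constraints and the edge
      sum.\<close>
    have "(\<Sum>e\<in>E. edge_diff (\<lambda>v. - x v) e) = (\<Sum>e\<in>E. edge_diff x e)"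
      by (rule sum.cong) (auto elim!: edge_doubletonE)
    with 2 show ?thesis
      using half_iso_number_le_of_small_positive_support[of "\<lambda>v. - x v"] x
      by (simp add: sum_negf)
  qed
qed

end
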